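(* For each $a\in(0,1)$, the function $$x\mapsto -\frac{d}{dx}\left[\frac{1}{F(a,1-a;1;x)}\right]$$ is absolutely monotonic on $(0,1)$.
   Context: A function $f$ is called absolutely monotonic on an interval $I$ if it has nonnegative derivatives of all orders on $I$, that is, $f^{(n)}(x)\ge 0$ for all $x\in I$ and all $n\ge 0$. $F(\alpha,\beta;c;x)=\sum_{n=0}^\infty\frac{(\alpha)_n(\beta)_n}{(c)_n}\frac{x^n}{n!}$, $|x|<1$, is the Gaussian hypergeometric function, with $(x)_0=1$, $(x)_n=x(x+1)\cdots(x+n-1)$. *)

theory Defs
  imports "HOL-Analysis.Analysis"
begin

(* The Gaussian hypergeometric function F(a,b;c;x); meaningful for \<bar>x\<bar> < 1 and c not a
   nonpositive integer. *)
definition hypergeometric_2F1 :: "real \<Rightarrow> real \<Rightarrow> real \<Rightarrow> real \<Rightarrow> real" where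
  "hypergeometric_2F1 a b c x =
     (\<Sum>n. pochhammer a n * pochhammer b n / pochhammer c n * (x ^ n / fact n))"

(* D n plays the role of the n-th derivative of f on I, so the existence of all derivatives is
   part of the definition.  Derivatives are taken within I (one-sided at endpoints belonging to I,
   ordinary at interior points); on a nondegenerate interval they are unique, so D is determined
   by f on I. *)
definition absolutely_monotonic_on :: "real set \<Rightarrow> (real \<Rightarrow> real) \<Rightarrow> bool" where
  "absolutely_monotonic_on I f \<longleftrightarrow>
     (\<exists>D. (\<forall>x\<in>I. D 0 x = f x) \<and>
          (\<forall>n. \<forall>x\<in>I. (D n has_real_derivative D (Suc n) x) (at x within I)) \<and>
          (\<forall>n. \<forall>x\<in>I. 0 \<le> D n x))"

end

theory Submission
  imports Defs "HOL-Real_Asymp.Real_Asymp"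
begin

unbundle no vec_syntax
unbundle fps_syntax

text \<open>
  Write \<open>F(a,1-a;1;x) = \<Sum>n. c n * x ^ n\<close>.  The ratios
  \<open>c (n + 1) / c n = (n + a) * (n + 1 - a) / (n + 1)\<^sup>2\<close> increase with \<open>n\<close>, so the positive
  coefficients \<open>c n\<close> form a log-convex sequence.  By Kaluza's theorem
  (\<open>kaluza\<close>), the reciprocal of a power series with positive log-convex coefficients has
  nonpositive coefficients from the linear one on; hence \<open>- (1 / F)'\<close>, which no longer sees the
  constant coefficient \<open>1\<close>, is a power series with nonnegative coefficients, and so are all of its
  derivatives.

  It remains to know that this formal reciprocal converges to \<open>1 / F\<close> on all of \<open>{-1<..<1}\<close> and
  not merely near \<open>0\<close>.  This also follows from Kaluza's theorem: the sign pattern bounds the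
  coefficients of the reciprocal by those of \<open>F\<close> up to a constant factor
  (\<open>abs_inverse_nth_le_log_convex\<close>), so its radius of convergence is at least that of \<open>F\<close>,
  which is \<open>1\<close>.
\<close>

text \<open>
  The local condition compares neighbouring ratios only; chaining it gives the comparison
  of any two ratios of consecutive terms.
\<close>
lemma log_convex_ratio_mono:
  fixes c :: "nat \<Rightarrow> real"
  assumes pos: "\<And>n. c n > 0"
    and log_convex: "\<And>n. c (Suc n) ^ 2 \<le> c n * c (Suc (Suc n))"
    and "m \<le> n"
  shows "c (Suc m) / c m \<le> c (Suc n) / c n"
proof -
  have "mono (\<lambda>n. c (Suc n) / c n)"
    unfolding mono_iff_le_Suc
  proof
    fix n
    show "c (Suc n) / c n \<le> c (Suc (Suc n)) / c (Suc n)"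
      using log_convex[of n] pos[of n] pos[of "Suc n"]
      by (simp add: field_simps power2_eq_square)
  qed
  then show ?thesis
    using \<open>m \<le> n\<close> by (auto dest: monoD)
qed

text \<open>
  Kaluza's theorem.  Let \<open>g\<close> be the reciprocal of \<open>f\<close>.  The convolution
  \<open>\<Sum>i\<le>n. g i * f (n - i)\<close> vanishes for \<open>n \<ge> 1\<close>.  Passing from \<open>n\<close> to
  \<open>n + 1\<close> multiplies the \<open>i\<close>-th term by a ratio \<open>f (n + 1 - i) / f (n - i)\<close>, which is largest
  for \<open>i = 0\<close>, the only term with a positive sign.  So the old terms then have a nonnegative
  sum, and the new term \<open>g (n + 1) * f 0\<close> must compensate for it.
\<close>
lemma kaluza:
  fixes f :: "real fps"
  assumes pos: "\<And>n. f $ n > 0"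
    and log_convex: "\<And>n. (f $ Suc n) ^ 2 \<le> f $ n * f $ Suc (Suc n)"
    and "n > 0"
  shows "inverse f $ n \<le> 0"
  using \<open>n > 0\<close>
proof (induction n rule: less_induct)
  case (less n)
  define g where "g = inverse f"
  have "g * f = 1"
    unfolding g_def using pos[of 0] by (intro inverse_mult_eq_1) simp
  then have conv: "(\<Sum>i\<le>k. g $ i * f $ (k - i)) = (if k = 0 then 1 else 0)" for k
    by (simp flip: fps_mult_nth add: atMost_atLeast0)
  obtain m where n: "n = Suc m"
    using less.prems by (cases n) auto
  define q where "q = f $ Suc m / f $ m"
  have "q > 0"
    using pos by (simp add: q_def)
  have termwise: "q * (g $ i * f $ (m - i)) \<le> g $ i * f $ (Suc m - i)" if "i \<le> m" for i
  proof (cases "i = 0")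
    case True
    then show ?thesis
      using pos[of m] by (simp add: q_def)
  next
    case False
    with that less.IH[of i] have "g $ i \<le> 0"
      by (simp add: g_def n)
    moreover have "f $ Suc (m - i) / f $ (m - i) \<le> q"
      unfolding q_def by (rule log_convex_ratio_mono) (use pos log_convex in auto)
    then have "f $ (Suc m - i) \<le> q * f $ (m - i)"
      using pos[of "m - i"] that by (simp add: field_simps Suc_diff_le)
    ultimately have "g $ i * (q * f $ (m - i)) \<le> g $ i * f $ (Suc m - i)"
      by (rule mult_left_mono_neg[rotated])
    then show ?thesis
      by (simp add: mult_ac)
  qed
  have "0 \<le> q * (\<Sum>i\<le>m. g $ i * f $ (m - i))"
    using \<open>q > 0\<close> by (simp add: conv)
  also have "\<dots> \<le> (\<Sum>i\<le>m. g $ i * f $ (Suc m - i))"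
    unfolding sum_distrib_left by (intro sum_mono termwise) auto
  also have "\<dots> = - (g $ n * f $ 0)"
    using conv[of n] by (simp add: n)
  finally show ?case
    using pos[of 0] by (simp add: g_def mult_le_0_iff)
qed

text \<open>
  In the vanishing convolution of \<open>f\<close> with its reciprocal, all terms but the first are nonpositive
  by Kaluza's theorem, so each of them, and in particular the last one, is at most as large as the
  first.
\<close>
lemma abs_inverse_nth_le_log_convex:
  fixes f :: "real fps"
  assumes pos: "\<And>n. f $ n > 0"
    and log_convex: "\<And>n. (f $ Suc n) ^ 2 \<le> f $ n * f $ Suc (Suc n)"
  shows "\<bar>inverse f $ n\<bar> \<le> f $ n / (f $ 0) ^ 2"
proof (cases n)
  case 0
  then show ?thesis
    using pos[of 0] by (simp add: field_simps power2_eq_square)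
next
  case (Suc m)
  define g where "g = inverse f"
  have nonpos: "g $ Suc i \<le> 0" for i
    unfolding g_def by (rule kaluza) (use pos log_convex in auto)
  have "0 = (g * f) $ n"
    using pos[of 0] Suc by (simp add: g_def inverse_mult_eq_1)
  also have "\<dots> = (\<Sum>i\<le>Suc m. g $ i * f $ (Suc m - i))"
    by (simp add: fps_mult_nth atMost_atLeast0 Suc)
  also have "\<dots> = g $ 0 * f $ n + (\<Sum>i<m. g $ Suc i * f $ (m - i)) + g $ n * f $ 0"
    by (subst sum.atMost_Suc, subst sum.atMost_shift) (simp add: Suc)
  also have "\<dots> \<le> g $ 0 * f $ n + g $ n * f $ 0"
    using nonpos pos by (simp add: sum_nonpos mult_nonpos_nonneg less_imp_le)
  finally have "- g $ n \<le> f $ n / (f $ 0) ^ 2"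
    using pos[of 0] by (simp add: g_def field_simps power2_eq_square)
  then show ?thesis
    using nonpos[of m] by (simp add: g_def Suc)
qed

lemma fps_conv_radius_inverse_log_convex:
  fixes f :: "real fps"
  assumes pos: "\<And>n. f $ n > 0"
    and log_convex: "\<And>n. (f $ Suc n) ^ 2 \<le> f $ n * f $ Suc (Suc n)"
  shows "fps_conv_radius f \<le> fps_conv_radius (inverse f)"
  unfolding fps_conv_radius_def
proof (rule conv_radius_geI_ex')
  fix r :: real
  assume r: "0 < r" "ereal r < conv_radius (fps_nth f)"
  then have "summable (\<lambda>n. f $ n * r ^ n / (f $ 0) ^ 2)"
    by (intro summable_divide summable_in_conv_radius) simp
  then show "summable (\<lambda>n. inverse f $ n * of_real r ^ n)"
  proof (rule summable_comparison_test')
    fix n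
    show "norm (inverse f $ n * of_real r ^ n) \<le> f $ n * r ^ n / (f $ 0) ^ 2"
      using mult_right_mono[OF abs_inverse_nth_le_log_convex[OF pos log_convex, of n], of "r ^ n"] r
      by (simp add: abs_mult)
  qed
qed

lemma absolutely_monotonic_on_eval_fps:
  fixes h :: "real fps"
  assumes nonneg: "\<And>n. 0 \<le> h $ n" and radius: "ereal r \<le> fps_conv_radius h"
  shows "absolutely_monotonic_on {0<..<r} (eval_fps h)"
proof -
  define D where "D n = (fps_deriv ^^ n) h" for n
  have D_radius: "ereal r \<le> fps_conv_radius (D n)" for n
    by (induction n) (use radius in \<open>auto simp: D_def intro: order_trans fps_conv_radius_deriv\<close>)
  have D_nonneg: "0 \<le> D n $ k" for n k
    by (induction n arbitrary: k) (use nonneg in \<open>auto simp: D_def\<close>)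
  have inside: "ereal (norm x) < fps_conv_radius (D n)" if "x \<in> {0<..<r}" for x n
    using that by (intro less_le_trans[OF _ D_radius]) auto
  show ?thesis
    unfolding absolutely_monotonic_on_def
  proof (intro exI[of _ "\<lambda>n. eval_fps (D n)"] conjI allI ballI)
    fix n x
    assume x: "x \<in> {0<..<r}"
    show "(eval_fps (D n) has_real_derivative eval_fps (D (Suc n)) x) (at x within {0<..<r})"
      using has_field_derivative_eval_fps[OF inside[OF x]] by (simp add: D_def)
    show "0 \<le> eval_fps (D n) x"
      unfolding eval_fps_def using x D_nonneg
      by (intro suminf_nonneg summable_in_conv_radius inside[unfolded fps_conv_radius_def] mult_nonneg_nonneg) auto
  qed (simp add: D_def)
qed

lemma absolutely_monotonic_on_cong:
  assumes "absolutely_monotonic_on I f" and "\<And>x. x \<in> I \<Longrightarrow> f x = g x"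
  shows "absolutely_monotonic_on I g"
  using assms unfolding absolutely_monotonic_on_def by auto

text \<open>
  On the common disc of convergence the formal reciprocal is the reciprocal function, so its
  formal derivative computes \<open>(1 / f)'\<close>, and Kaluza's theorem fixes the signs of its coefficients.
\<close>
lemma absolutely_monotonic_on_minus_deriv_reciprocal:
  fixes f :: "real fps"
  assumes pos: "\<And>n. f $ n > 0"
    and log_convex: "\<And>n. (f $ Suc n) ^ 2 \<le> f $ n * f $ Suc (Suc n)"
    and radius: "ereal r \<le> fps_conv_radius f"
  shows "absolutely_monotonic_on {0<..<r} (\<lambda>x. - deriv (\<lambda>t. 1 / eval_fps f t) x)"
proof (rule absolutely_monotonic_on_cong)
  define g where "g = inverse f"
  have g_radius: "ereal r \<le> fps_conv_radius g"
    unfolding g_def using radius fps_conv_radius_inverse_log_convex[OF pos log_convex]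
    by (rule order_trans)
  then have "ereal r \<le> fps_conv_radius (- fps_deriv g)"
    using fps_conv_radius_deriv[of g] by (auto intro: order_trans)
  moreover have "0 \<le> (- fps_deriv g) $ n" for n
    using kaluza[OF pos log_convex, of "Suc n"] by (simp add: g_def mult_nonneg_nonpos)
  ultimately show "absolutely_monotonic_on {0<..<r} (eval_fps (- fps_deriv g))"
    by (intro absolutely_monotonic_on_eval_fps)
  fix x
  assume x: "x \<in> {0<..<r}"
  have radii: "ereal (norm t) < fps_conv_radius f" "ereal (norm t) < fps_conv_radius g"
    if "t \<in> {0<..<r}" for t
    using that less_le_trans[OF _ radius] less_le_trans[OF _ g_radius] by auto
  have agree: "eval_fps g t = 1 / eval_fps f t" if "t \<in> {0<..<r}" for t
  proof -
    have "eval_fps g t * eval_fps f t = eval_fps (g * f) t"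
      using radii[OF that] by (simp add: eval_fps_mult)
    also have "g * f = 1"
      unfolding g_def using pos[of 0] by (intro inverse_mult_eq_1) simp
    finally have "eval_fps g t * eval_fps f t = 1"
      by simp
    then show ?thesis
      by (subst nonzero_eq_divide_eq) auto
  qed
  have "((\<lambda>t. 1 / eval_fps f t) has_field_derivative eval_fps (fps_deriv g) x) (at x)"
    using has_field_derivative_eval_fps[OF radii(2)[OF x]] open_greaterThanLessThan x agree
    by (rule has_field_derivative_transform_within_open)
  moreover have "eval_fps (- fps_deriv g) x = - eval_fps (fps_deriv g) x"
    using less_le_trans[OF radii(2)[OF x] fps_conv_radius_deriv]
    by (simp add: eval_fps_minus)
  ultimately show "eval_fps (- fps_deriv g) x = - deriv (\<lambda>t. 1 / eval_fps f t) x"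
    by (simp add: DERIV_imp_deriv)
qed

theorem theorem2p4:
  fixes a :: real
  assumes "a \<in> {0<..<1}"
  shows "absolutely_monotonic_on {0<..<1}
           (\<lambda>x. - deriv (\<lambda>t. 1 / hypergeometric_2F1 a (1 - a) 1 t) x)"
proof -
  define f where
    "f = Abs_fps (\<lambda>n. pochhammer a n * pochhammer (1 - a) n / (pochhammer 1 n * fact n))"
  define q where "q n = (a + real n) * (1 - a + real n) / (real n + 1) ^ 2" for n
  have pos: "f $ n > 0" for n
    using assms by (simp add: f_def pochhammer_pos)
  have f_Suc: "f $ Suc n = q n * f $ n" for n
    by (simp add: f_def q_def pochhammer_Suc power2_eq_square add_ac mult_ac)
  \<comment> \<open>With \<open>b = a * (1 - a)\<close> and \<open>m = n + 1\<close>, clearing denominators in \<open>q n \<le> q (Suc n)\<close> leaves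
    \<open>b * (2 * m + 1) \<le> m\<^sup>2 + m\<close>, and \<open>b\<close> is at most \<open>1 / 4\<close>.\<close>
  have q_mono: "q n \<le> q (Suc n)" for n
  proof -
    define b m where "b = a * (1 - a)" and "m = real n + 1"
    have "m \<ge> 1"
      by (simp add: m_def)
    have "b \<le> 1 / 4"
      using zero_le_power2[of "a - 1 / 2"] by (simp add: b_def field_simps power2_eq_square)
    then have "b * (2 * m + 1) \<le> 1 / 4 * (2 * m + 1)"
      using \<open>m \<ge> 1\<close> by (intro mult_right_mono) auto
    also have "\<dots> \<le> m * m + m"
      using \<open>m \<ge> 1\<close> mult_mono[of 1 m 1 m] by auto
    finally have "(m\<^sup>2 - m + b) * (m + 1)\<^sup>2 \<le> (m\<^sup>2 + m + b) * m\<^sup>2"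
      by (simp add: algebra_simps power2_eq_square)
    then have "(m\<^sup>2 - m + b) / m\<^sup>2 \<le> (m\<^sup>2 + m + b) / (m + 1)\<^sup>2"
      using \<open>m \<ge> 1\<close> by (simp add: divide_simps)
    moreover have "q n = (m\<^sup>2 - m + b) / m\<^sup>2" "q (Suc n) = (m\<^sup>2 + m + b) / (m + 1)\<^sup>2"
      by (simp_all add: q_def m_def b_def algebra_simps power2_eq_square)
    ultimately show ?thesis
      by simp
  qed
  have log_convex: "(f $ Suc n) ^ 2 \<le> f $ n * f $ Suc (Suc n)" for n
  proof -
    have "(f $ Suc n) ^ 2 = q n * (f $ n * f $ Suc n)"
      by (simp add: f_Suc[of n] power2_eq_square)
    also have "\<dots> \<le> q (Suc n) * (f $ n * f $ Suc n)"
      using q_mono pos by (intro mult_right_mono) (auto intro: less_imp_le)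
    also have "\<dots> = f $ n * f $ Suc (Suc n)"
      by (simp add: f_Suc[of "Suc n"])
    finally show ?thesis .
  qed
  have "fps_conv_radius f = 1"
    unfolding fps_conv_radius_def
  proof (rule conv_radius_ratio_limit_nonzero)
    have "norm (f $ n) / norm (f $ Suc n) = 1 / q n" for n
      using pos[of n] pos[of "Suc n"] by (simp add: f_Suc)
    moreover have "(\<lambda>n. 1 / q n) \<longlonglongrightarrow> 1"
      unfolding q_def by real_asymp
    ultimately show "(\<lambda>n. norm (f $ n) / norm (f $ Suc n)) \<longlonglongrightarrow> 1"
      by simp
  qed (simp_all add: one_ereal_def)
  then have "absolutely_monotonic_on {0<..<1} (\<lambda>x. - deriv (\<lambda>t. 1 / eval_fps f t) x)"
    using pos log_convex
    by (intro absolutely_monotonic_on_minus_deriv_reciprocal) (simp_all add: one_ereal_def)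
  moreover have "hypergeometric_2F1 a (1 - a) 1 = eval_fps f"
    by (simp add: fun_eq_iff hypergeometric_2F1_def eval_fps_def f_def)
  ultimately show ?thesis
    by simp
qed

end
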